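(* Let $d = d(n) \ge 1$ be an integer-valued function with $d(n) = o(\log n)$ as $n \to \infty$. Then for every sufficiently large $n$ there exist $m = m(n)$ and a set $X = X_n \subset \mathbb{R}^m$ with $|X| = n$, whose doubling dimension is $\Theta(\log n)$, such that the following holds, where $G : \mathbb{R}^m \to \mathbb{R}^{d}$ is a random projection, $F$ is the optimal facility location cost of $X$, $\widetilde{\mathcal{F}}$ is an optimal set of facilities for $GX$, and $\widetilde{F}$ is the cost of $\widetilde{\mathcal{F}}$ for $GX$. There are sequences $\delta_n \to 0$ and $K_n \to \infty$ with: (i) with probability at least $2/3$ over $G$, $\widetilde{F} \le \delta_n \cdot F$ (i.e. $\widetilde{F} = o(1)\cdot F$); (ii) with probability at least $2/3$ over $G$, the cost of $\widetilde{\mathcal{F}}$, when pulled back to $X$, is at least $K_n \cdot F$ (i.e. $\omega(1) \cdot F$) in the original space $\mathbb{R}^m$.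
   Context: All norms are Euclidean. Facility location (uniform, opening cost 1): for a finite nonempty dataset $Y$ in a Euclidean space, a solution is a nonempty subset $\mathcal{F} \subseteq Y$, with cost $|\mathcal{F}| + \sum_{y \in Y} \min_{f \in \mathcal{F}} \|y - f\|$; an optimal set of facilities minimizes this. A set of facilities $\widetilde{\mathcal{F}} \subseteq GX$ is pulled back to $X$ via the correspondence $Gx \leftrightarrow x$ (almost surely a bijection), i.e. to $\{x \in X : Gx \in \widetilde{\mathcal{F}}\}$, and its cost is then evaluated for the dataset $X$. Doubling dimension: for $x \in X$, $r > 0$ let $B(x,r) = \{y \in X : \|x-y\| \le r\}$. The doubling constant $\lambda_X$ is the smallest $\lambda$ such that for all $x \in X$, $r > 0$ there is $S \subseteq X$ with $|S| \le \lambda$ and $B(x,r) \subseteq \bigcup_{s \in S} B(s, r/2)$. The doubling dimension is $d_X = \log_2 \lambda_X$. A random projection from $\mathbb{R}^m$ to $\mathbb{R}^d$ is a random linear map $G$ given by a $d \times m$ matrix with i.i.d. entries drawn from $\mathcal{N}(0, 1/d)$ (variance $1/d$). *)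

theory Defs
  imports "HOL-Probability.Probability" "HOL-Library.Landau_Symbols"
begin

text \<open>
  Since dimensions vary with \<open>n\<close>, a point of \<open>m\<close>-dimensional Euclidean space is an element of
  \<^term>\<open>topspace (Euclidean_space m)\<close>, i.e. a function on \<^typ>\<open>nat\<close> that vanishes at all
  indices \<open>\<ge> m\<close>. A \<open>d \<times> m\<close> matrix is a function on index pairs in \<^term>\<open>{..<d} \<times> {..<m}\<close>.
\<close>

definition eucl_dist :: "nat \<Rightarrow> (nat \<Rightarrow> real) \<Rightarrow> (nat \<Rightarrow> real) \<Rightarrow> real" where
  "eucl_dist m x y = L2_set (\<lambda>i. x i - y i) {..<m}"

definition mat_apply :: "nat \<Rightarrow> nat \<Rightarrow> (nat \<times> nat \<Rightarrow> real) \<Rightarrow> (nat \<Rightarrow> real) \<Rightarrow> nat \<Rightarrow> real" where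
  "mat_apply d m g x = (\<lambda>i. if i < d then \<Sum>j<m. g (i, j) * x j else 0)"

text \<open>The second argument of \<^const>\<open>normal_density\<close> is the standard deviation.\<close>

definition random_projection :: "nat \<Rightarrow> nat \<Rightarrow> (nat \<times> nat \<Rightarrow> real) measure" where
  "random_projection d m =
     PiM ({..<d} \<times> {..<m}) (\<lambda>_. density lborel (normal_density 0 (1 / sqrt (real d))))"

definition fl_cost :: "nat \<Rightarrow> (nat \<Rightarrow> real) set \<Rightarrow> (nat \<Rightarrow> real) set \<Rightarrow> real" where
  "fl_cost m Y F = real (card F) + (\<Sum>y\<in>Y. MIN f\<in>F. eucl_dist m y f)"

definition fl_opt_cost :: "nat \<Rightarrow> (nat \<Rightarrow> real) set \<Rightarrow> real" where
  "fl_opt_cost m Y = (MIN F\<in>{F. F \<subseteq> Y \<and> F \<noteq> {}}. fl_cost m Y F)"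

definition fl_optimal :: "nat \<Rightarrow> (nat \<Rightarrow> real) set \<Rightarrow> (nat \<Rightarrow> real) set \<Rightarrow> bool" where
  "fl_optimal m Y F \<longleftrightarrow> is_arg_min (fl_cost m Y) (\<lambda>F. F \<subseteq> Y \<and> F \<noteq> {}) F"

definition set_ball :: "nat \<Rightarrow> (nat \<Rightarrow> real) set \<Rightarrow> (nat \<Rightarrow> real) \<Rightarrow> real \<Rightarrow> (nat \<Rightarrow> real) set" where
  "set_ball m X x r = {y \<in> X. eucl_dist m x y \<le> r}"

definition doubling_const :: "nat \<Rightarrow> (nat \<Rightarrow> real) set \<Rightarrow> nat" where
  "doubling_const m X =
     (LEAST k. \<forall>x\<in>X. \<forall>r>0. \<exists>S\<subseteq>X. finite S \<and> card S \<le> k \<and>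
        set_ball m X x r \<subseteq> (\<Union>s\<in>S. set_ball m X s (r / 2)))"

definition doubling_dim :: "nat \<Rightarrow> (nat \<Rightarrow> real) set \<Rightarrow> real" where
  "doubling_dim m X = log 2 (real (doubling_const m X))"

end

theory Submission
  imports Defs "HOL-Real_Asymp.Real_Asymp"
begin

text \<open>
  Take \<open>X\<close> to be the scaled standard basis \<open>q e\<^sub>1, \<dots>, q e\<^sub>n\<close>, with \<open>q \<rightarrow> \<infinity>\<close> slowly. All distances in \<open>X\<close>
  equal \<open>\<surd>2 q\<close>, so opening every point is optimal with cost \<open>n\<close>, the doubling constant is \<open>n\<close>, and
  any solution with at most \<open>n / 4\<close> facilities costs at least \<open>q n\<close>. After projection, however, the total
  \<open>\<ell>\<^sub>1\<close> norm of the points is at most \<open>3 q n \<surd>d\<close> with probability \<open>2/3\<close>, by Markov's inequality. Hence at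
  most \<open>3 n / q\<close> points have \<open>\<ell>\<^sub>1\<close> norm above \<open>q\<^sup>2 \<surd>d\<close>, and the others lie in at most
  \<open>3\<^sup>d 2\<^bsup>d(q\<^sup>3+1)\<^esup>\<close> cubes of diameter \<open>1/q\<close>. Opening the exceptional points and one point per cube costs
  \<open>o(n)\<close> as soon as \<open>4 q\<^sup>3 \<le> ln n / d\<close>. So an optimal solution of the projected instance opens only \<open>o(n)\<close>
  facilities, which is a bad solution in the original space because the projection is almost surely
  injective on \<open>X\<close>.
\<close>

subsection \<open>Covering by cubes\<close>

text \<open>The exponent stays linear in \<open>d\<close> when \<open>B\<close> is proportional to
  \<open>d\<close>. Counting the box around the l1 ball instead gives order (2B+1)^d, whose extra
  log d in the exponent is too much when \<open>d\<close> is only known to be o(log n).\<close>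

lemma card_int_lattice_l1_ball:
  fixes C :: "(nat \<Rightarrow> int) set" and B :: real
  assumes ext: "C \<subseteq> extensional {..<d}"
    and B: "\<And>k. k \<in> C \<Longrightarrow> (\<Sum>i<d. \<bar>real_of_int (k i)\<bar>) \<le> B"
  shows "finite C \<and> real (card C) \<le> 3 ^ d * 2 powr B"
proof -
  define N where "N = nat \<lceil>B\<rceil>"
  define P where "P = PiE {..<d} (\<lambda>_. {- int N..int N})"
  \<comment> \<open>Weight each lattice point \<open>k\<close> by \<open>2\<close> to the power of minus its \<open>\<ell>\<^sub>1\<close> norm: the weights factor over the coordinates.\<close>
  have C: "C \<subseteq> P"
  proof
    fix k assume k: "k \<in> C"
    have "k i \<in> {- int N..int N}" if "i < d" for i
    proof -
      have "\<bar>real_of_int (k i)\<bar> \<le> (\<Sum>i<d. \<bar>real_of_int (k i)\<bar>)"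
        using that by (intro member_le_sum) auto
      also have "\<dots> \<le> B" by (rule B[OF k])
      finally have "\<bar>k i\<bar> \<le> \<lceil>B\<rceil>" by linarith
      then have "\<bar>k i\<bar> \<le> int N" unfolding N_def by linarith
      then show ?thesis by auto
    qed
    then show "k \<in> P" using k ext by (auto simp: P_def PiE_def)
  qed
  have fP: "finite P" by (auto simp: P_def intro!: finite_PiE)
  \<comment> \<open>The base 3 of the bound is the two-sided geometric series with ratio 1/2 over
    all integers.\<close>
  have geom: "(\<Sum>k\<in>{- int N..int N}. (1/2::real) powr \<bar>real_of_int k\<bar>) \<le> 3"
  proof -
    have *: "(\<Sum>k\<in>{- int N..int N}. (1/2::real) powr \<bar>real_of_int k\<bar>) = 3 - 2 * (1/2) ^ N"
    proof (induction N)
      case (Suc N)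
      have eq: "{- int (Suc N)..int (Suc N)}
          = insert (int (Suc N)) (insert (- int (Suc N)) {- int N..int N})" by auto
      have "(1/2::real) powr \<bar>real_of_int (int (Suc N))\<bar> = (1/2) ^ Suc N"
        using powr_realpow[of "1/2::real" "Suc N"] by (simp add: add.commute)
      moreover have "(1/2::real) powr \<bar>real_of_int (- int (Suc N))\<bar> = (1/2) ^ Suc N"
        using powr_realpow[of "1/2::real" "Suc N"] by (simp add: add.commute)
      ultimately show ?case unfolding eq
        by (simp add: Suc del: of_nat_Suc)
    qed simp
    then show ?thesis by simp
  qed
  have "real (card C) * (1/2) powr B = (\<Sum>k\<in>C. (1/2) powr B)" by simp
  also have "\<dots> \<le> (\<Sum>k\<in>C. \<Prod>i<d. (1/2) powr \<bar>real_of_int (k i)\<bar>)"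
  proof (rule sum_mono)
    fix k assume "k \<in> C"
    have "(1/2::real) powr B \<le> (1/2) powr (\<Sum>i<d. \<bar>real_of_int (k i)\<bar>)"
      using B[OF \<open>k \<in> C\<close>] by (intro powr_mono') auto
    also have "\<dots> = (\<Prod>i<d. (1/2) powr \<bar>real_of_int (k i)\<bar>)"
      by (subst powr_sum) auto
    finally show "(1/2::real) powr B \<le> (\<Prod>i<d. (1/2) powr \<bar>real_of_int (k i)\<bar>)" .
  qed
  also have "\<dots> \<le> (\<Sum>k\<in>P. \<Prod>i<d. (1/2) powr \<bar>real_of_int (k i)\<bar>)"
    by (intro sum_mono2 fP C prod_nonneg) auto
  also have "\<dots> = (\<Prod>i<d. \<Sum>k\<in>{- int N..int N}. (1/2) powr \<bar>real_of_int k\<bar>)"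
    unfolding P_def by (subst prod_sum_PiE) auto
  also have "\<dots> \<le> (\<Prod>i<d. 3)" by (intro prod_mono conjI sum_nonneg geom) auto
  finally have "real (card C) * (1/2) powr B \<le> 3 ^ d" by simp
  then have "real (card C) \<le> 3 ^ d * 2 powr B"
    by (simp add: powr_divide field_simps)
  then show ?thesis using finite_subset[OF C fP] by simp
qed

section \<open>Facility location costs and the solution built from cubes\<close>

lemma eucl_dist_nonneg: "0 \<le> eucl_dist m x y"
  by (simp add: eucl_dist_def)

lemma eucl_dist_refl [simp]: "eucl_dist m x x = 0"
  by (simp add: eucl_dist_def L2_set_def)

lemma Min_eucl_dist_nonneg:
  assumes "finite F" "F \<noteq> {}"
  shows "0 \<le> (MIN f\<in>F. eucl_dist m y f)"
  using assms by (simp add: eucl_dist_nonneg)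

lemma fl_cost_ge_card:
  assumes "finite F" "F \<noteq> {}"
  shows "real (card F) \<le> fl_cost m Y F"
  using assms by (auto simp: fl_cost_def intro!: sum_nonneg Min_eucl_dist_nonneg)

lemma fl_cost_le:
  assumes Y: "finite Y" and F: "F \<subseteq> Y" "F \<noteq> {}" and e: "0 \<le> e"
    and near: "\<And>y. y \<in> Y \<Longrightarrow> \<exists>f\<in>F. eucl_dist m y f \<le> e"
  shows "fl_cost m Y F \<le> real (card F) + real (card Y) * e"
proof -
  have "(MIN f\<in>F. eucl_dist m y f) \<le> e" if y: "y \<in> Y" for y
    using near[OF y] F finite_subset[OF F(1) Y] by (subst Min_le_iff) auto
  then have "(\<Sum>y\<in>Y. MIN f\<in>F. eucl_dist m y f) \<le> (\<Sum>y\<in>Y. e)"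
    by (rule sum_mono)
  then show ?thesis by (simp add: fl_cost_def)
qed

text \<open>The three terms are: the points of l1 norm above \<open>M\<close>, which are opened
  themselves and number at most \<open>Z / M\<close>; one facility for each occupied cube of side
  \<open>s\<close>; and the connection cost, at most one cube diagonal per point. Only the total l1
  norm is controlled, so no single point needs to be bounded.\<close>

lemma fl_cost_cells_le:
  fixes Y :: "(nat \<Rightarrow> real) set" and s M e :: real
  assumes Y: "finite Y" "Y \<noteq> {}" and s: "s > 0" and M: "M > 0"
    and Z: "(\<Sum>y\<in>Y. \<Sum>i<d. \<bar>y i\<bar>) \<le> Z"
  shows "\<exists>F\<subseteq>Y. F \<noteq> {} \<and>
    fl_cost d Y F \<le> Z / M + 3 ^ d * 2 powr (M / s + d) + real (card Y) * (s * sqrt (real d))"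
proof -
  define bad where "bad = {y\<in>Y. (\<Sum>i<d. \<bar>y i\<bar>) > M}"
  \<comment> \<open>The restriction to \<open>{..<d}\<close> makes two labels equal exactly when the
    points share a cube, and puts labels in the form required by the lattice count.\<close>
  define c :: "(nat \<Rightarrow> real) \<Rightarrow> nat \<Rightarrow> int" where "c y = (\<lambda>i\<in>{..<d}. \<lfloor>y i / s\<rfloor>)" for y
  define C where "C = c ` (Y - bad)"
  \<comment> \<open>Facilities must be data points, so each cube is represented by one of its own
    points rather than by its centre.\<close>
  define F where "F = bad \<union> inv_into (Y - bad) c ` C"
  have C: "finite C \<and> real (card C) \<le> 3 ^ d * 2 powr (M / s + d)"
  proof (rule card_int_lattice_l1_ball)
    show "C \<subseteq> extensional {..<d}" by (auto simp: C_def c_def)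
    fix k assume "k \<in> C"
    then obtain y where y: "y \<in> Y" "y \<notin> bad" "k = c y" by (auto simp: C_def)
    \<comment> \<open>Rounding down changes each coordinate by at most 1, whence the summand
      \<open>d\<close> in the radius \<open>M / s + d\<close>.\<close>
    have "(\<Sum>i<d. \<bar>real_of_int (k i)\<bar>) \<le> (\<Sum>i<d. \<bar>y i\<bar> / s + 1)"
    proof (rule sum_mono)
      fix i assume i: "i \<in> {..<d}"
      have "\<bar>real_of_int (k i)\<bar> = \<bar>real_of_int \<lfloor>y i / s\<rfloor>\<bar>" using i y by (simp add: c_def)
      also have "\<dots> \<le> \<bar>y i / s\<bar> + 1" by linarith
      finally show "\<bar>real_of_int (k i)\<bar> \<le> \<bar>y i\<bar> / s + 1" using s by (simp add: abs_divide)
    qed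
    also have "\<dots> = (\<Sum>i<d. \<bar>y i\<bar>) / s + d" by (simp add: sum.distrib sum_divide_distrib)
    also have "\<dots> \<le> M / s + d" using y s by (auto simp: bad_def intro!: divide_right_mono)
    finally show "(\<Sum>i<d. \<bar>real_of_int (k i)\<bar>) \<le> M / s + d" .
  qed
  have inv: "inv_into (Y - bad) c k \<in> Y - bad" "c (inv_into (Y - bad) c k) = k" if "k \<in> C" for k
    using that unfolding C_def by (rule inv_into_into, rule f_inv_into_f)
  have FY: "F \<subseteq> Y" using inv by (auto simp: F_def bad_def)
  have near: "\<exists>f\<in>F. eucl_dist d y f \<le> s * sqrt (real d)" if y: "y \<in> Y" for y
  proof (cases "y \<in> bad")
    case True
    then show ?thesis using s by (intro bexI[of _ y]) (auto simp: F_def)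
  next
    case False
    define f where "f = inv_into (Y - bad) c (c y)"
    have cy: "c y \<in> C" using y False by (auto simp: C_def)
    have cf: "c f = c y" unfolding f_def by (rule inv(2)[OF cy])
    have "eucl_dist d y f \<le> sqrt (\<Sum>i<d. s\<^sup>2)" unfolding eucl_dist_def L2_set_def
    proof (intro real_sqrt_le_mono sum_mono)
      fix i assume i: "i \<in> {..<d}"
      have "\<lfloor>f i / s\<rfloor> = \<lfloor>y i / s\<rfloor>" using fun_cong[OF cf, of i] i by (simp add: c_def)
      then have "\<bar>y i / s - f i / s\<bar> \<le> 1" by linarith
      then have "\<bar>(y i - f i) / s\<bar> \<le> 1" by (simp add: diff_divide_distrib)
      then have "\<bar>y i - f i\<bar> \<le> s" using s by (simp add: abs_divide)
      then show "(y i - f i)\<^sup>2 \<le> s\<^sup>2" using s by (simp add: abs_le_square_iff[symmetric])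
    qed
    also have "\<dots> = s * sqrt (real d)" using s by (simp add: real_sqrt_mult)
    finally show ?thesis using cy by (intro bexI[of _ f]) (auto simp: F_def f_def)
  qed
  \<comment> \<open>Markov's inequality for the counting measure on \<open>Y\<close>.\<close>
  have "real (card bad) * M = (\<Sum>y\<in>bad. M)" by simp
  also have "\<dots> \<le> (\<Sum>y\<in>bad. \<Sum>i<d. \<bar>y i\<bar>)" by (rule sum_mono) (auto simp: bad_def)
  also have "\<dots> \<le> (\<Sum>y\<in>Y. \<Sum>i<d. \<bar>y i\<bar>)"
    using Y by (intro sum_mono2 sum_nonneg) (auto simp: bad_def)
  also note Z
  finally have cb: "real (card bad) \<le> Z / M" using M by (simp add: field_simps)
  have "card F \<le> card bad + card (inv_into (Y - bad) c ` C)" unfolding F_def by (rule card_Un_le)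
  also have "\<dots> \<le> card bad + card C" using C by (intro add_left_mono card_image_le) auto
  finally have cF: "real (card F) \<le> Z / M + 3 ^ d * 2 powr (M / s + d)" using cb C by linarith
  have F0: "F \<noteq> {}" using near Y by blast
  have "fl_cost d Y F \<le> real (card F) + real (card Y) * (s * sqrt (real d))"
    using s by (intro fl_cost_le Y FY F0 near) auto
  then show ?thesis using cF FY F0 by (intro exI[of _ F]) auto
qed

subsection \<open>The scaled standard basis\<close>

definition scaled_basis_vec :: "real \<Rightarrow> nat \<Rightarrow> nat \<Rightarrow> real" where
  "scaled_basis_vec q j = (\<lambda>i. if i = j then q else 0)"

definition scaled_basis :: "real \<Rightarrow> nat \<Rightarrow> (nat \<Rightarrow> real) set" where
  "scaled_basis q n = scaled_basis_vec q ` {..<n}"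

lemma inj_scaled_basis_vec: "q > 0 \<Longrightarrow> inj (scaled_basis_vec q)"
  by (auto simp: inj_def scaled_basis_vec_def fun_eq_iff split: if_splits)

lemma finite_scaled_basis [simp]: "finite (scaled_basis q n)"
  by (simp add: scaled_basis_def)

lemma card_scaled_basis: "q > 0 \<Longrightarrow> card (scaled_basis q n) = n"
  using inj_on_subset[OF inj_scaled_basis_vec subset_UNIV] by (simp add: scaled_basis_def card_image)

lemma scaled_basis_subset_Euclidean_space:
  "scaled_basis q n \<subseteq> topspace (Euclidean_space n)"
  by (auto simp: scaled_basis_def scaled_basis_vec_def topspace_Euclidean_space)

lemma eucl_dist_scaled_basis:
  assumes q: "q > 0" and x: "x \<in> scaled_basis q n" "y \<in> scaled_basis q n" "x \<noteq> y"
  shows "eucl_dist n x y = sqrt 2 * q"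
proof -
  obtain j k where jk: "j < n" "k < n" "x = scaled_basis_vec q j" "y = scaled_basis_vec q k" "j \<noteq> k"
    using x by (auto simp: scaled_basis_def)
  have "(\<Sum>i<n. (x i - y i)\<^sup>2) = (\<Sum>i<n. (if i = j then q\<^sup>2 else 0) + (if i = k then q\<^sup>2 else 0))"
    using jk by (intro sum.cong) (auto simp: scaled_basis_vec_def)
  also have "\<dots> = 2 * q\<^sup>2" using jk by (simp add: sum.distrib)
  finally show ?thesis using q by (simp add: eucl_dist_def L2_set_def real_sqrt_mult)
qed

lemma mat_apply_scaled_basis_vec:
  "j < n \<Longrightarrow> mat_apply d n g (scaled_basis_vec q j) = (\<lambda>i. if i < d then q * g (i, j) else 0)"
  by (auto simp: mat_apply_def scaled_basis_vec_def if_distrib cong: if_cong)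

text \<open>A ball whose radius is the common distance sqrt 2 * q contains all points, while a ball
  of half that radius contains only its centre. A cover therefore needs every point, and the whole
  set always is a cover.\<close>

lemma doubling_const_scaled_basis:
  assumes q: "q > 0" and n: "n \<ge> 1"
  shows "doubling_const n (scaled_basis q n) = n"
  unfolding doubling_const_def
proof (rule Least_equality)
  let ?X = "scaled_basis q n"
  have "set_ball n ?X x r \<subseteq> (\<Union>s\<in>?X. set_ball n ?X s (r / 2))" if "r > 0" for x r
    using that by (auto simp: set_ball_def intro!: bexI)
  then show "\<forall>x\<in>?X. \<forall>r>0. \<exists>S\<subseteq>?X. finite S \<and> card S \<le> n \<and>
        set_ball n ?X x r \<subseteq> (\<Union>s\<in>S. set_ball n ?X s (r / 2))"
    by (intro ballI allI impI exI[of _ ?X]) (auto simp: card_scaled_basis[OF q])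
next
  let ?X = "scaled_basis q n"
  fix k assume k: "\<forall>x\<in>?X. \<forall>r>0. \<exists>S\<subseteq>?X. finite S \<and> card S \<le> k \<and>
        set_ball n ?X x r \<subseteq> (\<Union>s\<in>S. set_ball n ?X s (r / 2))"
  have "scaled_basis_vec q 0 \<in> ?X" using n by (auto simp: scaled_basis_def)
  moreover have "sqrt 2 * q > 0" using q by simp
  ultimately have "\<exists>S\<subseteq>?X. finite S \<and> card S \<le> k \<and>
      set_ball n ?X (scaled_basis_vec q 0) (sqrt 2 * q) \<subseteq> (\<Union>s\<in>S. set_ball n ?X s (sqrt 2 * q / 2))"
    by (rule k[rule_format])
  then obtain S where S: "S \<subseteq> ?X" "finite S" "card S \<le> k"
    "set_ball n ?X (scaled_basis_vec q 0) (sqrt 2 * q) \<subseteq> (\<Union>s\<in>S. set_ball n ?X s (sqrt 2 * q / 2))"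
    by blast
  have "?X \<subseteq> S"
  proof
    fix x assume x: "x \<in> ?X"
    have "eucl_dist n (scaled_basis_vec q 0) x \<le> sqrt 2 * q"
      using eucl_dist_scaled_basis[OF q \<open>scaled_basis_vec q 0 \<in> ?X\<close> x] q
      by (cases "scaled_basis_vec q 0 = x") auto
    then obtain s where s: "s \<in> S" "eucl_dist n s x \<le> sqrt 2 * q / 2"
      using S(4) x by (auto simp: set_ball_def)
    have "s = x"
      using eucl_dist_scaled_basis[OF q _ x, of s] s S(1) q by (cases "s = x") auto
    then show "x \<in> S" using s by simp
  qed
  then have "card ?X \<le> card S" using S by (intro card_mono)
  then show "n \<le> k" using S card_scaled_basis[OF q, of n] by simp
qed

text \<open>An unopened point is equally far from all facilities, so the cost depends on
  \<open>A\<close> only through its size.\<close>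

lemma fl_cost_scaled_basis:
  assumes q: "q > 0" and A: "A \<subseteq> scaled_basis q n" "A \<noteq> {}"
  shows "fl_cost n (scaled_basis q n) A = real (card A) + real (n - card A) * (sqrt 2 * q)"
proof -
  let ?X = "scaled_basis q n"
  have fA: "finite A" using A(1) finite_scaled_basis by (rule finite_subset)
  have 1: "(MIN f\<in>A. eucl_dist n x f) = 0" if "x \<in> A" for x
    using that fA eucl_dist_nonneg by (intro Min_eqI) (auto intro: image_eqI[of _ _ x])
  have 2: "(MIN f\<in>A. eucl_dist n x f) = sqrt 2 * q" if "x \<in> ?X - A" for x
  proof -
    have "eucl_dist n x f = sqrt 2 * q" if "f \<in> A" for f
      using that \<open>x \<in> ?X - A\<close> A by (intro eucl_dist_scaled_basis q) auto
    then have "eucl_dist n x ` A = {sqrt 2 * q}" using A by auto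
    then show ?thesis by simp
  qed
  have "(\<Sum>x\<in>?X. MIN f\<in>A. eucl_dist n x f)
      = (\<Sum>x\<in>?X - A. MIN f\<in>A. eucl_dist n x f) + (\<Sum>x\<in>A. MIN f\<in>A. eucl_dist n x f)"
    using A by (intro sum.subset_diff) auto
  also have "\<dots> = real (card (?X - A)) * (sqrt 2 * q)" using 1 2 by simp
  also have "card (?X - A) = n - card A"
    using A fA card_scaled_basis[OF q, of n] by (subst card_Diff_subset) auto
  finally show ?thesis by (simp add: fl_cost_def)
qed

text \<open>Closing a facility saves 1 and adds a connection cost sqrt 2 * q, which is at least 1.
  Hence opening everything is optimal.\<close>

lemma fl_opt_cost_scaled_basis:
  assumes q: "q \<ge> 1" and n: "n \<ge> 1"
  shows "fl_opt_cost n (scaled_basis q n) = real n"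
  unfolding fl_opt_cost_def
proof (rule Min_eqI)
  let ?X = "scaled_basis q n"
  have q0: "q > 0" using q by simp
  show "finite (fl_cost n ?X ` {F. F \<subseteq> ?X \<and> F \<noteq> {}})" by simp
  have "?X \<noteq> {}" using n by (auto simp: scaled_basis_def lessThan_empty_iff)
  then show "real n \<in> fl_cost n ?X ` {F. F \<subseteq> ?X \<and> F \<noteq> {}}"
    using fl_cost_scaled_basis[OF q0, of ?X n] card_scaled_basis[OF q0, of n]
    by (intro image_eqI[of _ _ ?X]) auto
  fix c assume "c \<in> fl_cost n ?X ` {F. F \<subseteq> ?X \<and> F \<noteq> {}}"
  then obtain F where F: "F \<subseteq> ?X" "F \<noteq> {}" "c = fl_cost n ?X F" by auto
  have "card F \<le> n" using card_mono[OF _ F(1)] card_scaled_basis[OF q0, of n] by simp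
  have "1 * 1 \<le> sqrt 2 * q" using q by (intro mult_mono) auto
  then have "real (n - card F) * 1 \<le> real (n - card F) * (sqrt 2 * q)"
    by (intro mult_left_mono) auto
  then show "real n \<le> c"
    using \<open>card F \<le> n\<close> F fl_cost_scaled_basis[OF q0 F(1,2)] by simp
qed

subsection \<open>Gaussian matrices\<close>

abbreviation entry_law :: "nat \<Rightarrow> real measure" where
  "entry_law d \<equiv> density lborel (normal_density 0 (1 / sqrt (real d)))"

lemma prob_space_entry_law: "d \<ge> 1 \<Longrightarrow> prob_space (entry_law d)"
  by (rule prob_space_normal_density) simp

lemma prob_space_random_projection: "d \<ge> 1 \<Longrightarrow> prob_space (random_projection d m)"
  unfolding random_projection_def by (intro prob_space_PiM prob_space_entry_law)

lemma measurable_random_projection_entry [measurable]: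
  assumes "i < d" "j < m"
  shows "(\<lambda>g. g (i, j)) \<in> borel_measurable (random_projection d m)"
proof -
  have "(\<lambda>g. g (i, j)) \<in> measurable (random_projection d m) (entry_law d)"
    unfolding random_projection_def using assms by (intro measurable_component_singleton) auto
  then show ?thesis by (simp cong: measurable_cong_sets)
qed

lemma distr_random_projection_entry:
  assumes "d \<ge> 1" "i < d" "j < m"
  shows "distr (random_projection d m) (entry_law d) (\<lambda>g. g (i, j)) = entry_law d"
  unfolding random_projection_def using assms prob_space_entry_law
  by (intro distr_PiM_component) auto

lemma abs_entry_law:
  assumes "d \<ge> 1"
  shows "integrable (entry_law d) abs" "(\<integral>x. \<bar>x\<bar> \<partial>entry_law d) \<le> 1 / sqrt (real d)"
proof -
  \<comment> \<open>The first absolute moment of a centred normal variable is its standard deviation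
    times sqrt (2 / pi); the last factor is then bounded by 1.\<close>
  have "has_bochner_integral lborel
      (\<lambda>x. normal_density 0 (1 / sqrt (real d)) x * \<bar>x\<bar>) (1 / sqrt (real d) * sqrt (2 / pi))"
    using normal_moment_abs_odd[of "1 / sqrt (real d)" 0 0] assms by simp
  then have *: "has_bochner_integral (entry_law d) abs (1 / sqrt (real d) * sqrt (2 / pi))"
    by (subst has_bochner_integral_density) auto
  then show "integrable (entry_law d) abs" by (rule integrable.intros)
  have "sqrt (2 / pi) \<le> 1" using pi_gt3 by simp
  then have "1 / sqrt (real d) * sqrt (2 / pi) \<le> 1 / sqrt (real d) * 1"
    by (intro mult_left_mono) auto
  then show "(\<integral>x. \<bar>x\<bar> \<partial>entry_law d) \<le> 1 / sqrt (real d)"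
    using has_bochner_integral_integral_eq[OF *] by simp
qed

lemma abs_random_projection_entry:
  assumes "d \<ge> 1" "i < d" "j < m"
  shows "integrable (random_projection d m) (\<lambda>g. \<bar>g (i, j)\<bar>)"
    and "(\<integral>g. \<bar>g (i, j)\<bar> \<partial>random_projection d m) \<le> 1 / sqrt (real d)"
proof -
  have m: "(\<lambda>g. g (i, j)) \<in> measurable (random_projection d m) (entry_law d)"
    using measurable_random_projection_entry[OF assms(2,3)] by (simp cong: measurable_cong_sets)
  show "integrable (random_projection d m) (\<lambda>g. \<bar>g (i, j)\<bar>)"
    using abs_entry_law(1)[OF assms(1)] m distr_random_projection_entry[OF assms]
    by (subst integrable_distr_eq[OF m, symmetric]) auto
  have "(\<integral>g. \<bar>g (i, j)\<bar> \<partial>random_projection d m)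
      = (\<integral>x. \<bar>x\<bar> \<partial>distr (random_projection d m) (entry_law d) (\<lambda>g. g (i, j)))"
    by (subst integral_distr[OF m]) auto
  then show "(\<integral>g. \<bar>g (i, j)\<bar> \<partial>random_projection d m) \<le> 1 / sqrt (real d)"
    using abs_entry_law(2)[OF assms(1)] distr_random_projection_entry[OF assms] by simp
qed

text \<open>There are n d entries of mean absolute value at most 1 / sqrt d, so the expected sum is
  at most n sqrt d. The factor 3 makes the failure probability in Markov's inequality 1/3.\<close>

lemma prob_sum_abs_entries:
  assumes d: "d \<ge> 1" and n: "n \<ge> 1"
  shows "\<P>(g in random_projection d n.
      (\<Sum>j<n. \<Sum>i<d. \<bar>g (i, j)\<bar>) < 3 * real n * sqrt (real d)) \<ge> 2 / 3"
proof -
  let ?M = "random_projection d n"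
  let ?u = "\<lambda>g :: nat \<times> nat \<Rightarrow> real. \<Sum>j<n. \<Sum>i<d. \<bar>g (i, j)\<bar>"
  let ?c = "3 * real n * sqrt (real d)"
  interpret prob_space ?M by (rule prob_space_random_projection[OF d])
  have int: "integrable ?M ?u"
    using abs_random_projection_entry(1)[OF d] by (intro Bochner_Integration.integrable_sum) auto
  have c: "?c > 0" using d n by simp
  have "(\<integral>g. ?u g \<partial>?M) = (\<Sum>j<n. \<Sum>i<d. \<integral>g. \<bar>g (i, j)\<bar> \<partial>?M)"
    using abs_random_projection_entry(1)[OF d] by (subst Bochner_Integration.integral_sum) auto
  also have "\<dots> \<le> (\<Sum>j<n. \<Sum>i<d. 1 / sqrt (real d))"
    using abs_random_projection_entry(2)[OF d] by (intro sum_mono) auto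
  also have "\<dots> = real n * sqrt (real d)" by (simp add: real_div_sqrt)
  finally have E: "(\<integral>g. ?u g \<partial>?M) \<le> real n * sqrt (real d)" .
  have "\<P>(g in ?M. ?u g \<ge> ?c) \<le> (\<integral>g. ?u g \<partial>?M) / ?c"
    using c by (intro integral_Markov_inequality_measure[where A = "{}"] int) (auto intro!: sum_nonneg)
  also have "\<dots> \<le> (real n * sqrt (real d)) / ?c" using c E by (intro divide_right_mono) auto
  also have "\<dots> = 1 / 3" using d n by simp
  finally have le: "\<P>(g in ?M. ?u g \<ge> ?c) \<le> 1 / 3" .
  have [measurable]: "?u \<in> borel_measurable ?M" using int by simp
  have "\<P>(g in ?M. \<not> ?u g \<ge> ?c) = 1 - \<P>(g in ?M. ?u g \<ge> ?c)"
    by (rule prob_neg) measurable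
  with le show ?thesis by (simp add: not_le)
qed

text \<open>By Fubini: once all entries except the one at \<open>p\<close> are fixed, equality
  forces that entry to take one prescribed value, and a law with a density has no atoms.\<close>

lemma AE_random_projection_entries_neq:
  assumes d: "d \<ge> 1" and p: "p \<in> {..<d} \<times> {..<m}" "p' \<in> {..<d} \<times> {..<m}" "p \<noteq> p'"
  shows "AE g in random_projection d m. g p \<noteq> g p'"
proof -
  let ?I = "{..<d} \<times> {..<m} - {p}" and ?N = "entry_law d"
  let ?M = "random_projection d m"
  have ins: "insert p ?I = {..<d} \<times> {..<m}" using p by auto
  have M: "?M = PiM (insert p ?I) (\<lambda>_. ?N)" by (simp only: ins random_projection_def)
  interpret N: prob_space ?N by (rule prob_space_entry_law[OF d])
  interpret product_sigma_finite "\<lambda>_. ?N" by standard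
  have [measurable]: "(\<lambda>g. g p) \<in> borel_measurable ?M" "(\<lambda>g. g p') \<in> borel_measurable ?M"
    using p measurable_random_projection_entry[of "fst p" d "snd p" m]
      measurable_random_projection_entry[of "fst p'" d "snd p'" m]
    by (auto simp: mem_Times_iff)
  have S: "{g \<in> space ?M. g p = g p'} \<in> sets ?M" by measurable
  have single: "emeasure ?N {a} = 0" for a
    by (subst emeasure_density) (auto simp: nn_integral_0_iff_AE intro!: AE_mp[OF AE_lborel_singleton[of a]])
  have "emeasure ?M {g \<in> space ?M. g p = g p'}
      = (\<integral>\<^sup>+g. indicator {g \<in> space ?M. g p = g p'} g \<partial>?M)" using S by simp
  also have "\<dots> = (\<integral>\<^sup>+x. \<integral>\<^sup>+y. indicator {g \<in> space ?M. g p = g p'} (x(p := y)) \<partial>?N \<partial>PiM ?I (\<lambda>_. ?N))"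
    using S unfolding M by (intro product_nn_integral_insert) auto
  \<comment> \<open>Since \<open>p'\<close> differs from \<open>p\<close>, the update at
    \<open>p\<close> leaves the value at \<open>p'\<close> unchanged.\<close>
  also have "\<dots> \<le> (\<integral>\<^sup>+x. \<integral>\<^sup>+y. indicator {x p'} y \<partial>?N \<partial>PiM ?I (\<lambda>_. ?N))"
    using p by (intro nn_integral_mono) (auto split: split_indicator)
  also have "\<dots> = 0" using single by simp
  finally have "emeasure ?M {g \<in> space ?M. g p = g p'} = 0" by simp
  then show ?thesis using S by (intro AE_I[where N = "{g \<in> space ?M. g p = g p'}"]) auto
qed

subsection \<open>Measurability\<close>

text \<open>
  Summing over the domain with weights makes the measurability of a facility location cost evident,
  although the projection may collapse points.
\<close>
lemma sum_image_fibre: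
  fixes h :: "'b \<Rightarrow> real"
  assumes "finite A"
  shows "(\<Sum>y\<in>f ` A. h y) = (\<Sum>x\<in>A. h (f x) / (\<Sum>a\<in>A. if f a = f x then 1 else 0))"
proof -
  let ?c = "\<lambda>x. (\<Sum>a\<in>A. if f a = f x then 1 else 0 :: real)"
  have c: "?c x = real (card {a\<in>A. f a = f x})" for x
    using assms by (simp add: sum.If_cases Int_def)
  have "(\<Sum>x\<in>A. h (f x) / ?c x) = (\<Sum>y\<in>f ` A. \<Sum>x | x \<in> A \<and> f x = y. h (f x) / ?c x)"
    by (rule sum.image_gen[OF assms])
  also have "\<dots> = (\<Sum>y\<in>f ` A. h y)"
  proof (rule sum.cong[OF refl])
    fix y assume y: "y \<in> f ` A"
    have "(\<Sum>x | x \<in> A \<and> f x = y. h (f x) / ?c x)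
        = (\<Sum>x | x \<in> A \<and> f x = y. h y / real (card {a\<in>A. f a = y}))"
      by (intro sum.cong) (auto simp: c)
    also have "\<dots> = h y" using y assms by (auto simp: card_eq_0_iff)
    finally show "(\<Sum>x | x \<in> A \<and> f x = y. h (f x) / ?c x) = h y" .
  qed
  finally show ?thesis by simp
qed

lemma borel_measurable_mat_apply [measurable]:
  "(\<lambda>g. mat_apply d m g x i) \<in> borel_measurable (random_projection d m)"
proof (cases "i < d")
  case True
  then have "(\<lambda>g. g (i, j) * x j) \<in> borel_measurable (random_projection d m)" if "j < m" for j
    using measurable_random_projection_entry[OF True that] by measurable
  then show ?thesis using True by (auto simp: mat_apply_def intro!: borel_measurable_sum)
qed (simp add: mat_apply_def)

text \<open>Images vanish from index \<open>d\<close> on, so an equality of functions becomes a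
  finite conjunction, which is evidently measurable in \<open>g\<close>.\<close>

lemma mat_apply_eq_iff:
  "mat_apply d m g x = mat_apply d m g y \<longleftrightarrow> (\<forall>i\<in>{..<d}. mat_apply d m g x i = mat_apply d m g y i)"
  by (auto simp: fun_eq_iff) (auto simp: mat_apply_def)

lemma measurable_mat_apply_eq [measurable]:
  "Measurable.pred (random_projection d m) (\<lambda>g. mat_apply d m g x = mat_apply d m g y)"
proof -
  have [measurable]: "Measurable.pred (random_projection d m)
      (\<lambda>g. mat_apply d m g x i = mat_apply d m g y i)" for i
    unfolding Measurable.pred_def
    by (intro borel_measurable_eq borel_measurable_mat_apply)
  show ?thesis unfolding mat_apply_eq_iff by measurable
qed

lemma borel_measurable_fl_cost_mat_apply [measurable]:
  assumes "finite X" "finite A"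
  shows "(\<lambda>g. fl_cost d (mat_apply d m g ` X) (mat_apply d m g ` A))
    \<in> borel_measurable (random_projection d m)"
proof -
  have "fl_cost d (mat_apply d m g ` X) (mat_apply d m g ` A) =
     (\<Sum>x\<in>A. 1 / (\<Sum>a\<in>A. if mat_apply d m g a = mat_apply d m g x then 1 else 0)) +
     (\<Sum>x\<in>X. (MIN a\<in>A. eucl_dist d (mat_apply d m g x) (mat_apply d m g a)) /
        (\<Sum>a\<in>X. if mat_apply d m g a = mat_apply d m g x then 1 else 0))" for g
    \<comment> \<open>The number of facilities is treated as the sum of the constant 1 over the
      image of \<open>A\<close>.\<close>
    using sum_image_fibre[OF assms(2), of "\<lambda>_. 1" "mat_apply d m g"]
    unfolding fl_cost_def sum_image_fibre[OF assms(1)] by (simp add: image_image)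
  moreover have "(\<lambda>g. eucl_dist d (mat_apply d m g x) (mat_apply d m g a))
      \<in> borel_measurable (random_projection d m)" for x a
    unfolding eucl_dist_def L2_set_def by measurable
  ultimately show ?thesis
    using assms by simp
qed

text \<open>Every subset of the image is the image of a subset of \<open>X\<close>. Quantifying over
  the latter replaces a range that depends on the random map by a fixed one, which is finite when
  \<open>X\<close> is; this is what the measurability proofs need.\<close>

lemma fl_optimal_image_iff:
  "(\<forall>Ft. fl_optimal d (f ` X) Ft \<longrightarrow> Q Ft) \<longleftrightarrow>
   (\<forall>A\<in>Pow X - {{}}. (\<forall>A'\<in>Pow X - {{}}. fl_cost d (f ` X) (f ` A) \<le> fl_cost d (f ` X) (f ` A'))
      \<longrightarrow> Q (f ` A))"
proof -
  have opt: "fl_optimal d (f ` X) (f ` A) \<longleftrightarrow>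
      (\<forall>A'\<in>Pow X - {{}}. fl_cost d (f ` X) (f ` A) \<le> fl_cost d (f ` X) (f ` A'))"
    if "A \<in> Pow X - {{}}" for A
  proof -
    have "fl_optimal d (f ` X) (f ` A) \<longleftrightarrow>
        (\<forall>F'\<subseteq>f ` X. F' \<noteq> {} \<longrightarrow> fl_cost d (f ` X) (f ` A) \<le> fl_cost d (f ` X) F')"
      using that unfolding fl_optimal_def is_arg_min_linorder by blast
    then show ?thesis unfolding all_subset_image by auto
  qed
  have ex: "\<exists>A\<in>Pow X - {{}}. Ft = f ` A" if "fl_optimal d (f ` X) Ft" for Ft
    using that unfolding fl_optimal_def is_arg_min_def subset_image_iff by blast
  show ?thesis
  proof (intro iffI allI ballI impI)
    fix A assume "\<forall>Ft. fl_optimal d (f ` X) Ft \<longrightarrow> Q Ft" "A \<in> Pow X - {{}}"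
      "\<forall>A'\<in>Pow X - {{}}. fl_cost d (f ` X) (f ` A) \<le> fl_cost d (f ` X) (f ` A')"
    then show "Q (f ` A)" using opt by simp
  next
    fix Ft assume *: "fl_optimal d (f ` X) Ft" and
      Q: "\<forall>A\<in>Pow X - {{}}. (\<forall>A'\<in>Pow X - {{}}. fl_cost d (f ` X) (f ` A) \<le> fl_cost d (f ` X) (f ` A'))
        \<longrightarrow> Q (f ` A)"
    obtain A where A: "A \<in> Pow X - {{}}" "Ft = f ` A" using ex[OF *] by blast
    show "Q Ft" using * opt[OF A(1)] Q[rule_format, OF A(1)] unfolding A(2) by blast
  qed
qed

lemma measurable_fl_optimal_image:
  assumes "finite X"
    and "\<And>A. A \<subseteq> X \<Longrightarrow> Measurable.pred (random_projection d m) (\<lambda>g. Q g (mat_apply d m g ` A))"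
  shows "Measurable.pred (random_projection d m) (\<lambda>g.
    \<forall>Ft. fl_optimal d (mat_apply d m g ` X) Ft \<longrightarrow> Q g Ft)"
proof -
  have le: "Measurable.pred (random_projection d m) (\<lambda>g.
      fl_cost d (mat_apply d m g ` X) (mat_apply d m g ` A)
      \<le> fl_cost d (mat_apply d m g ` X) (mat_apply d m g ` A'))" if "A \<subseteq> X" "A' \<subseteq> X" for A A'
    using borel_measurable_fl_cost_mat_apply[OF assms(1), of A] that
      borel_measurable_fl_cost_mat_apply[OF assms(1), of A'] finite_subset[OF _ assms(1)]
    by (simp add: Measurable.pred_def borel_measurable_le)
  show ?thesis unfolding fl_optimal_image_iff using assms
    by (intro pred_intros_finite pred_intros_logic le assms(2)) auto
qed

lemma measurable_fl_optimal_cost: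
  assumes "finite X"
  shows "Measurable.pred (random_projection d m) (\<lambda>g.
    \<forall>Ft. fl_optimal d (mat_apply d m g ` X) Ft \<longrightarrow> fl_cost d (mat_apply d m g ` X) Ft \<le> c)"
proof (rule measurable_fl_optimal_image[OF assms])
  fix A assume "A \<subseteq> X"
  then have [measurable]: "(\<lambda>g. fl_cost d (mat_apply d m g ` X) (mat_apply d m g ` A))
      \<in> borel_measurable (random_projection d m)"
    using assms finite_subset by (intro borel_measurable_fl_cost_mat_apply)
  show "Measurable.pred (random_projection d m)
      (\<lambda>g. fl_cost d (mat_apply d m g ` X) (mat_apply d m g ` A) \<le> c)" by measurable
qed

text \<open>The pullback takes only finitely many values \<open>B\<close>, and each value is
  described by finitely many equalities between projected points. Hence \<open>P\<close> can be
  arbitrary.\<close>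

lemma measurable_fl_optimal_pullback:
  assumes "finite X"
  shows "Measurable.pred (random_projection d m) (\<lambda>g.
    \<forall>Ft. fl_optimal d (mat_apply d m g ` X) Ft \<longrightarrow> P {x \<in> X. mat_apply d m g x \<in> Ft})"
proof (rule measurable_fl_optimal_image[OF assms])
  fix A assume "A \<subseteq> X"
  then have "finite A" using assms finite_subset by auto
  have "P {x \<in> X. mat_apply d m g x \<in> mat_apply d m g ` A} \<longleftrightarrow>
      (\<exists>B\<in>{B \<in> Pow X. P B}. \<forall>x\<in>X. x \<in> B \<longleftrightarrow> (\<exists>a\<in>A. mat_apply d m g x = mat_apply d m g a))" for g
  proof -
    have "(\<forall>x\<in>X. x \<in> B \<longleftrightarrow> (\<exists>a\<in>A. mat_apply d m g x = mat_apply d m g a)) \<longleftrightarrow>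
        B = {x \<in> X. mat_apply d m g x \<in> mat_apply d m g ` A}" if "B \<subseteq> X" for B
      using that by auto
    then show ?thesis by auto
  qed
  moreover have "Measurable.pred (random_projection d m) (\<lambda>g.
      \<exists>B\<in>{B \<in> Pow X. P B}. \<forall>x\<in>X. x \<in> B \<longleftrightarrow> (\<exists>a\<in>A. mat_apply d m g x = mat_apply d m g a))"
  proof (intro pred_intros_finite(4))
    show "finite {B \<in> Pow X. P B}" using assms by simp
    show "Measurable.pred (random_projection d m)
        (\<lambda>g. \<forall>x\<in>X. x \<in> B \<longleftrightarrow> (\<exists>a\<in>A. mat_apply d m g x = mat_apply d m g a))" for B
      using assms \<open>finite A\<close> by measurable
  qed
  ultimately show "Measurable.pred (random_projection d m)
      (\<lambda>g. P {x \<in> X. mat_apply d m g x \<in> mat_apply d m g ` A})" by simp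
qed

subsection \<open>Cost bounds for the projected instance\<close>

text \<open>The projected points are \<open>q\<close> times the columns of the matrix. Only an
  inequality holds, because coinciding columns contribute once to the image.\<close>

lemma sum_abs_mat_apply_scaled_basis_le:
  assumes "q \<ge> 0"
  shows "(\<Sum>y\<in>mat_apply d n g ` scaled_basis q n. \<Sum>i<d. \<bar>y i\<bar>) \<le> q * (\<Sum>j<n. \<Sum>i<d. \<bar>g (i, j)\<bar>)"
proof -
  have "(\<Sum>y\<in>mat_apply d n g ` scaled_basis q n. \<Sum>i<d. \<bar>y i\<bar>)
      = (\<Sum>y\<in>(\<lambda>j. mat_apply d n g (scaled_basis_vec q j)) ` {..<n}. \<Sum>i<d. \<bar>y i\<bar>)"
    by (simp add: scaled_basis_def image_image)
  also have "\<dots> \<le> (\<Sum>j<n. \<Sum>i<d. \<bar>mat_apply d n g (scaled_basis_vec q j) i\<bar>)"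
    using sum_image_le[of "{..<n}" "\<lambda>y. \<Sum>i<d. \<bar>y i\<bar>" "\<lambda>j. mat_apply d n g (scaled_basis_vec q j)"]
    by (auto simp: o_def sum_nonneg)
  also have "\<dots> = q * (\<Sum>j<n. \<Sum>i<d. \<bar>g (i, j)\<bar>)"
    using assms by (simp add: mat_apply_scaled_basis_vec abs_mult sum_distrib_left)
  finally show ?thesis .
qed

lemma fl_optimal_projection_le:
  assumes d: "d \<ge> 1" and n: "n \<ge> 1" and q: "q \<ge> 1"
    and g: "(\<Sum>j<n. \<Sum>i<d. \<bar>g (i, j)\<bar>) < 3 * real n * sqrt (real d)"
    and opt: "fl_optimal d (mat_apply d n g ` scaled_basis q n) Ft"
  shows "fl_cost d (mat_apply d n g ` scaled_basis q n) Ft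
    \<le> 4 * real n / q + 3 ^ d * 2 powr (real d * (q ^ 3 + 1))"
proof -
  let ?Y = "mat_apply d n g ` scaled_basis q n"
  \<comment> \<open>Cubes of side \<open>s\<close> have diagonal 1 / q, so connections cost at most
    n / q in total. With \<open>M\<close> as below, \<open>Z / M\<close> is 3 n / q and
    \<open>M / s\<close> is d q^3.\<close>
  define s where "s = 1 / (q * sqrt (real d))"
  define M where "M = q\<^sup>2 * sqrt (real d)"
  define Z where "Z = q * (3 * real n * sqrt (real d))"
  have pos: "q > 0" "sqrt (real d) > 0" using d q by auto
  then have sM: "s > 0" "M > 0" by (simp_all add: s_def M_def)
  have "(\<Sum>y\<in>?Y. \<Sum>i<d. \<bar>y i\<bar>) \<le> q * (\<Sum>j<n. \<Sum>i<d. \<bar>g (i, j)\<bar>)"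
    using q by (intro sum_abs_mat_apply_scaled_basis_le) simp
  also have "\<dots> \<le> Z" unfolding Z_def using g q by (intro mult_left_mono) auto
  finally have Z: "(\<Sum>y\<in>?Y. \<Sum>i<d. \<bar>y i\<bar>) \<le> Z" .
  have Y: "finite ?Y" "?Y \<noteq> {}" using n by (auto simp: scaled_basis_def lessThan_empty_iff)
  obtain F where F: "F \<subseteq> ?Y" "F \<noteq> {}"
    "fl_cost d ?Y F \<le> Z / M + 3 ^ d * 2 powr (M / s + d) + real (card ?Y) * (s * sqrt (real d))"
    using fl_cost_cells_le[OF Y sM Z] by blast
  have "Z / M = 3 * real n / q"
    using pos by (simp add: Z_def M_def power2_eq_square)
  moreover have "M / s + d = real d * (q ^ 3 + 1)"
  proof -
    have "M / s = q ^ 3 * (sqrt (real d) * sqrt (real d))"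
      by (simp add: M_def s_def power2_eq_square power3_eq_cube)
    then show ?thesis by (simp add: algebra_simps)
  qed
  moreover have "s * sqrt (real d) = 1 / q" using pos by (simp add: s_def)
  moreover have "real (card ?Y) * (1 / q) \<le> real n / q"
    using card_image_le[of "scaled_basis q n" "mat_apply d n g"] card_scaled_basis[of q n] pos
    by (simp add: divide_right_mono)
  moreover have "fl_cost d ?Y Ft \<le> fl_cost d ?Y F"
    using opt F(1,2) by (auto simp: fl_optimal_def is_arg_min_linorder)
  moreover have "4 * real n / q = 3 * real n / q + real n / q"
    by (simp add: add_divide_distrib[symmetric])
  ultimately show ?thesis using F(3) by simp
qed

text \<open>The first coordinate already separates the points; row 0 exists because
  \<open>d \<ge> 1\<close>.\<close>

lemma inj_on_mat_apply_scaled_basis: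
  assumes "d \<ge> 1" "q > 0" and g: "\<And>j k. j < n \<Longrightarrow> k < n \<Longrightarrow> j \<noteq> k \<Longrightarrow> g (0, j) \<noteq> g (0, k)"
  shows "inj_on (mat_apply d n g) (scaled_basis q n)"
proof (rule inj_onI)
  fix x y assume xy: "x \<in> scaled_basis q n" "y \<in> scaled_basis q n"
    and eq: "mat_apply d n g x = mat_apply d n g y"
  then obtain j k where jk: "j < n" "k < n" "x = scaled_basis_vec q j" "y = scaled_basis_vec q k"
    by (auto simp: scaled_basis_def)
  have "q * g (0, j) = q * g (0, k)"
    using fun_cong[OF eq, of 0] assms(1) jk by (simp add: mat_apply_scaled_basis_vec)
  then have "j = k" using g jk assms(2) by auto
  then show "x = y" using jk by simp
qed

text \<open>Injectivity preserves the number of facilities, so at least 3/4 of the points stay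
  unopened and each pays sqrt 2 * q.\<close>

lemma fl_cost_pullback_ge:
  assumes q: "q \<ge> 1"
    and inj: "inj_on (mat_apply d n g) (scaled_basis q n)"
    and Ft: "Ft \<subseteq> mat_apply d n g ` scaled_basis q n" "Ft \<noteq> {}" "real (card Ft) \<le> real n / 4"
  shows "q * real n \<le> fl_cost n (scaled_basis q n) {x \<in> scaled_basis q n. mat_apply d n g x \<in> Ft}"
proof -
  let ?P = "{x \<in> scaled_basis q n. mat_apply d n g x \<in> Ft}"
  have im: "mat_apply d n g ` ?P = Ft" using Ft(1) by auto
  have "card ?P = card Ft"
    using card_image[OF inj_on_subset[OF inj, of ?P]] im by simp
  then have cP: "real (card ?P) \<le> real n / 4" using Ft by simp
  have P: "?P \<subseteq> scaled_basis q n" "?P \<noteq> {}" using im Ft(2) by auto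
  \<comment> \<open>The constant 4/3 cancels the fraction 3/4 of unopened points, leaving exactly
    \<open>q * real n\<close>.\<close>
  have sq: "4 / 3 \<le> sqrt 2" by (rule real_le_rsqrt) (simp add: power2_eq_square)
  have "real (n - card ?P) \<ge> 3 / 4 * real n" using cP by linarith
  moreover have "4 / 3 * q \<le> sqrt 2 * q" using sq q by (intro mult_right_mono) auto
  ultimately have "(3 / 4 * real n) * (4 / 3 * q) \<le> real (n - card ?P) * (sqrt 2 * q)"
    using q by (intro mult_mono) auto
  moreover have "(3 / 4 * real n) * (4 / 3 * q) = q * real n" by simp
  moreover have "fl_cost n (scaled_basis q n) ?P = real (card ?P) + real (n - card ?P) * (sqrt 2 * q)"
    using q by (intro fl_cost_scaled_basis P) simp
  ultimately show ?thesis by linarith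
qed

text \<open>Both claims come from the same event of probability at least 2/3, on which the entries
  have small total absolute value; the second also discards the null set where two entries of row 0
  agree. In \<open>\<delta>\<close>, 4 / q accounts for exceptional points and connections, and 1 /
  sqrt n for the cubes.\<close>

lemma scaled_basis_projection_bounds:
  assumes d: "d \<ge> 1" and n: "n \<ge> 1" and q: "q \<ge> 1"
    and cells: "3 ^ d * 2 powr (real d * (q ^ 3 + 1)) \<le> sqrt (real n)"
    and \<delta>: "\<delta> = 4 / q + 1 / sqrt (real n)" "\<delta> \<le> 1 / 4"
  shows "\<P>(g in random_projection d n.
           \<forall>Ft. fl_optimal d (mat_apply d n g ` scaled_basis q n) Ft \<longrightarrow>
             fl_cost d (mat_apply d n g ` scaled_basis q n) Ft
               \<le> \<delta> * fl_opt_cost n (scaled_basis q n)) \<ge> 2 / 3" (is "?p1 \<ge> _")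
    and "\<P>(g in random_projection d n.
           \<forall>Ft. fl_optimal d (mat_apply d n g ` scaled_basis q n) Ft \<longrightarrow>
             fl_cost n (scaled_basis q n) {x \<in> scaled_basis q n. mat_apply d n g x \<in> Ft}
               \<ge> q * fl_opt_cost n (scaled_basis q n)) \<ge> 2 / 3" (is "?p2 \<ge> _")
proof -
  let ?M = "random_projection d n" and ?X = "scaled_basis q n"
  let ?good = "\<lambda>g :: nat \<times> nat \<Rightarrow> real. (\<Sum>j<n. \<Sum>i<d. \<bar>g (i, j)\<bar>) < 3 * real n * sqrt (real d)"
  interpret prob_space ?M by (rule prob_space_random_projection[OF d])
  have opt: "fl_opt_cost n ?X = real n" by (rule fl_opt_cost_scaled_basis[OF q n])
  have "real n / sqrt (real n) = sqrt (real n)" by (rule real_div_sqrt) simp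
  then have \<delta>n: "\<delta> * real n = 4 * real n / q + sqrt (real n)"
    by (simp add: \<delta>(1) algebra_simps)
  have upper: "fl_cost d (mat_apply d n g ` ?X) Ft \<le> \<delta> * real n"
    if "?good g" "fl_optimal d (mat_apply d n g ` ?X) Ft" for g Ft
    using fl_optimal_projection_le[OF d n q that] cells unfolding \<delta>n by linarith
  have [measurable]: "(\<lambda>g. g (i, j)) \<in> borel_measurable ?M" if "i \<in> {..<d}" "j \<in> {..<n}" for i j
    using that by (intro measurable_random_projection_entry) auto
  have "2 / 3 \<le> \<P>(g in ?M. ?good g)" by (rule prob_sum_abs_entries[OF d n])
  also have "\<dots> \<le> ?p1"
  proof (rule finite_measure_mono)
    \<comment> \<open>Monotonicity requires the larger event to be measurable;
      \<open>measure\<close> is 0 by default on sets that are not.\<close>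
    show "{g \<in> space ?M. \<forall>Ft. fl_optimal d (mat_apply d n g ` ?X) Ft \<longrightarrow>
        fl_cost d (mat_apply d n g ` ?X) Ft \<le> \<delta> * fl_opt_cost n ?X} \<in> sets ?M"
      by (rule measurable_fl_optimal_cost[OF finite_scaled_basis, unfolded Measurable.pred_def])
  qed (use upper opt in auto)
  finally show "2 / 3 \<le> ?p1" .
  have "AE g in ?M. g (0, j) \<noteq> g (0, k)" if "j \<in> {..<n}" "k \<in> {..<n} - {j}" for j k
    using that d by (intro AE_random_projection_entries_neq) auto
  then have AE: "AE g in ?M. \<forall>j\<in>{..<n}. \<forall>k\<in>{..<n} - {j}. g (0, j) \<noteq> g (0, k)"
    by (intro AE_finite_allI) auto
  have "2 / 3 \<le> \<P>(g in ?M. ?good g)" by (rule prob_sum_abs_entries[OF d n])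
  also have "\<dots> \<le> ?p2"
  proof (rule finite_measure_mono_AE)
    show "{g \<in> space ?M. \<forall>Ft. fl_optimal d (mat_apply d n g ` ?X) Ft \<longrightarrow>
        q * fl_opt_cost n ?X \<le> fl_cost n ?X {x \<in> ?X. mat_apply d n g x \<in> Ft}} \<in> sets ?M"
      by (rule measurable_fl_optimal_pullback[OF finite_scaled_basis, unfolded Measurable.pred_def])
    show "AE g in ?M. g \<in> {g \<in> space ?M. ?good g} \<longrightarrow>
      g \<in> {g \<in> space ?M. \<forall>Ft. fl_optimal d (mat_apply d n g ` ?X) Ft \<longrightarrow>
        q * fl_opt_cost n ?X \<le> fl_cost n ?X {x \<in> ?X. mat_apply d n g x \<in> Ft}}"
      using AE
    proof eventually_elim
      case (elim g)
      have inj: "inj_on (mat_apply d n g) ?X"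
        using elim d q by (intro inj_on_mat_apply_scaled_basis) auto
      have "q * fl_opt_cost n ?X \<le> fl_cost n ?X {x \<in> ?X. mat_apply d n g x \<in> Ft}"
        if g: "?good g" and Ft: "fl_optimal d (mat_apply d n g ` ?X) Ft" for Ft
      proof -
        have sub: "Ft \<subseteq> mat_apply d n g ` ?X" "Ft \<noteq> {}"
          using Ft by (auto simp: fl_optimal_def is_arg_min_def)
        \<comment> \<open>A cheap solution opens few facilities: each costs 1, and
          \<open>\<delta> \<le> 1 / 4\<close> gives the n / 4 needed for the pullback.\<close>
        have "real (card Ft) \<le> fl_cost d (mat_apply d n g ` ?X) Ft"
          using sub finite_subset[OF sub(1)] by (intro fl_cost_ge_card) auto
        also have "\<dots> \<le> \<delta> * real n" by (rule upper[OF g Ft])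
        also have "\<dots> \<le> 1 / 4 * real n" using \<delta>(2) by (intro mult_right_mono) auto
        finally have "real (card Ft) \<le> real n / 4" by simp
        then show ?thesis using fl_cost_pullback_ge[OF q inj sub] opt by simp
      qed
      then show ?case by auto
    qed
  qed
  finally show "2 / 3 \<le> ?p2" .
qed

section \<open>Choice of \<open>q\<close> and the limit in n\<close>

lemma cells_le_sqrt:
  fixes q :: real
  assumes n: "n \<ge> 1" and q: "q ^ 3 \<ge> 3" and w: "4 * q ^ 3 * real d \<le> ln (real n)"
  shows "3 ^ d * 2 powr (real d * (q ^ 3 + 1)) \<le> sqrt (real n)"
proof -
  \<comment> \<open>The logarithm of the number of cubes is at most d (q^3 + 3), hence at most 2 d
    q^3 by \<open>q ^ 3 \<ge> 3\<close>; the factor 4 in the hypothesis turns this into half of ln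
    n.\<close>
  have "ln (3::real) \<le> 2" "ln (2::real) \<le> 1" using ln_le_minus_one[of 3] ln_le_minus_one[of 2] by auto
  then have "ln 3 + (q ^ 3 + 1) * ln 2 \<le> 2 + (q ^ 3 + 1) * 1"
    using q by (intro add_mono mult_left_mono) auto
  also have "\<dots> \<le> 2 * q ^ 3" using q by simp
  finally have "real d * (ln 3 + (q ^ 3 + 1) * ln 2) \<le> real d * (2 * q ^ 3)"
    by (rule mult_left_mono) simp
  then have "real d * ln 3 + real d * (q ^ 3 + 1) * ln 2 \<le> ln (real n) / 2"
    using w by (simp add: algebra_simps)
  then have "exp (real d * ln 3 + real d * (q ^ 3 + 1) * ln 2) \<le> exp (ln (real n) / 2)" by simp
  also have "\<dots> = sqrt (real n)"
    using n by (simp add: powr_half_sqrt[symmetric] powr_def)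
  also have "exp (real d * ln 3 + real d * (q ^ 3 + 1) * ln 2)
      = 3 ^ d * 2 powr (real d * (q ^ 3 + 1))"
    by (simp add: exp_add powr_def exp_of_nat_mult)
  finally show ?thesis .
qed

theorem theorem6p1:
  fixes d :: "nat \<Rightarrow> nat"
  assumes d_ge_1: "\<And>n. d n \<ge> 1"
    and d_small: "(\<lambda>n. real (d n)) \<in> o(\<lambda>n. ln (real n))"
  shows "\<exists>(m :: nat \<Rightarrow> nat) (X :: nat \<Rightarrow> (nat \<Rightarrow> real) set) (\<delta> :: nat \<Rightarrow> real) (K :: nat \<Rightarrow> real).
    \<delta> \<longlonglongrightarrow> 0 \<and> filterlim K at_top sequentially \<and>
    (\<lambda>n. doubling_dim (m n) (X n)) \<in> \<Theta>(\<lambda>n. ln (real n)) \<and>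
    (\<forall>\<^sub>F n in sequentially.
       X n \<subseteq> topspace (Euclidean_space (m n)) \<and> finite (X n) \<and> card (X n) = n \<and>
       \<P>(g in random_projection (d n) (m n).
           \<forall>Ft. fl_optimal (d n) (mat_apply (d n) (m n) g ` X n) Ft \<longrightarrow>
             fl_cost (d n) (mat_apply (d n) (m n) g ` X n) Ft \<le> \<delta> n * fl_opt_cost (m n) (X n))
         \<ge> 2 / 3 \<and>
       \<P>(g in random_projection (d n) (m n).
           \<forall>Ft. fl_optimal (d n) (mat_apply (d n) (m n) g ` X n) Ft \<longrightarrow>
             fl_cost (m n) (X n) {x \<in> X n. mat_apply (d n) (m n) g x \<in> Ft}
               \<ge> K n * fl_opt_cost (m n) (X n))
         \<ge> 2 / 3)"
proof -
  \<comment> \<open>This is the largest value with 4 q^3 d \<le> ln n, and it tends to infinity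
    precisely because d = o(log n).\<close>
  define q where "q n = root 3 (ln (real n) / real (d n) / 4)" for n
  define \<delta> where "\<delta> n = 4 / q n + 1 / sqrt (real n)" for n
  have q_top: "filterlim q at_top sequentially"
    unfolding filterlim_at_top
  proof
    fix Z :: real
    \<comment> \<open>With this constant, d \<le> c ln n says that ln n / (4 d) is at least max 1 Z
      cubed; the maximum keeps \<open>c\<close> positive for every \<open>Z\<close>.\<close>
    define c where "c = 1 / (4 * (max 1 Z) ^ 3)"
    have c: "c > 0" by (simp add: c_def)
    show "\<forall>\<^sub>F n in sequentially. Z \<le> q n"
      using landau_o.smallD[OF d_small c] eventually_ge_at_top[of 1]
    proof eventually_elim
      case (elim n)
      have "ln (real n) \<ge> 0" using elim(2) by simp
      then have "(max 1 Z) ^ 3 \<le> ln (real n) / real (d n) / 4"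
        using elim(1) d_ge_1[of n] by (simp add: c_def field_simps)
      then have "root 3 ((max 1 Z) ^ 3) \<le> q n" unfolding q_def by simp
      then have "max 1 Z \<le> q n" by (simp add: odd_real_root_power_cancel)
      then show ?case by simp
    qed
  qed
  have \<delta>0: "\<delta> \<longlonglongrightarrow> 0"
  proof -
    have "(\<lambda>n. 4 / q n) \<longlonglongrightarrow> 0"
      using filterlim_at_top_imp_at_infinity[OF q_top] by (rule tendsto_divide_0[OF tendsto_const])
    moreover have "(\<lambda>n. 1 / sqrt (real n)) \<longlonglongrightarrow> 0"
      by real_asymp
    ultimately have "\<delta> \<longlonglongrightarrow> 0 + 0" unfolding \<delta>_def by (rule tendsto_add)
    then show ?thesis by simp
  qed
  \<comment> \<open>The bound 2 is a convenient threshold: it gives q^3 \<ge> 8, more than the 3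
    needed to count the cubes.\<close>
  have ev: "\<forall>\<^sub>F n in sequentially. n \<ge> 1 \<and> q n \<ge> 2 \<and> \<delta> n \<le> 1 / 4"
    using eventually_ge_at_top[of "1 :: nat"] q_top[unfolded filterlim_at_top, rule_format, of 2]
      order_tendstoD(2)[OF \<delta>0, of "1 / 4", simplified]
    by eventually_elim simp
  show ?thesis
  \<comment> \<open>The witnesses are fixed by unification with the goals shown below: ambient
    dimension n, the scaled basis with scale \<open>q n\<close>, the sequence
    \<open>\<delta>\<close>, and \<open>q\<close> itself as \<open>K\<close>.\<close>
  proof (intro exI conjI)
    show "\<delta> \<longlonglongrightarrow> 0" "filterlim q at_top sequentially" by fact+
    have "(\<lambda>n. log 2 (real n)) \<in> \<Theta>(\<lambda>n. ln (real n))" by real_asymp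
    moreover have "\<forall>\<^sub>F n in sequentially. doubling_dim n (scaled_basis (q n) n) = log 2 (real n)"
      using ev by eventually_elim (simp add: doubling_dim_def doubling_const_scaled_basis)
    ultimately show "(\<lambda>n. doubling_dim n (scaled_basis (q n) n)) \<in> \<Theta>(\<lambda>n. ln (real n))"
      by (subst landau_theta.in_cong)
    show "\<forall>\<^sub>F n in sequentially.
       scaled_basis (q n) n \<subseteq> topspace (Euclidean_space n) \<and> finite (scaled_basis (q n) n) \<and>
       card (scaled_basis (q n) n) = n \<and>
       \<P>(g in random_projection (d n) n.
           \<forall>Ft. fl_optimal (d n) (mat_apply (d n) n g ` scaled_basis (q n) n) Ft \<longrightarrow>
             fl_cost (d n) (mat_apply (d n) n g ` scaled_basis (q n) n) Ft
               \<le> \<delta> n * fl_opt_cost n (scaled_basis (q n) n)) \<ge> 2 / 3 \<and>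
       \<P>(g in random_projection (d n) n.
           \<forall>Ft. fl_optimal (d n) (mat_apply (d n) n g ` scaled_basis (q n) n) Ft \<longrightarrow>
             fl_cost n (scaled_basis (q n) n) {x \<in> scaled_basis (q n) n. mat_apply (d n) n g x \<in> Ft}
               \<ge> q n * fl_opt_cost n (scaled_basis (q n) n)) \<ge> 2 / 3"
      using ev
    proof eventually_elim
      case (elim n)
      have "q n ^ 3 = ln (real n) / real (d n) / 4"
        using elim by (simp add: q_def odd_real_root_pow)
      then have w: "4 * q n ^ 3 * real (d n) \<le> ln (real n)" using d_ge_1[of n] by simp
      have "2 ^ 3 \<le> q n ^ 3" using elim by (intro power_mono) auto
      then have cells: "3 ^ d n * 2 powr (real (d n) * (q n ^ 3 + 1)) \<le> sqrt (real n)"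
        using elim w by (intro cells_le_sqrt) auto
      show ?case
        using elim scaled_basis_projection_bounds[OF d_ge_1[of n] _ _ cells \<delta>_def[of n]]
        by (simp add: card_scaled_basis scaled_basis_subset_Euclidean_space)
    qed
  qed
qed

end
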